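(* Assume (A1)--(A4) and let $\lambda>0$. Let $(\delta_n)_{n\in\mathbb{N}}\subset[0,\infty)$ be a sequence of noise levels with $\delta_n\to\delta\in[0,\infty)$, and suppose that $\pi_{y^{\delta_n}}\to\pi_{y^\delta}$ in total variation. For each $n$ let $$\phi_n\in\operatorname*{arg\,min}_{\phi\in K}\ J_2(\mathcal{G}_\phi\,|\,\lambda,\pi_{y^{\delta_n}}).$$ Then, up to sub-sequences, $\mathcal{G}_{\phi_n}\to\mathcal{G}_{\phi^*}$ pointwise, for some $$\phi^*\in\operatorname*{arg\,min}_{\phi\in K}\ J_2(\mathcal{G}_\phi\,|\,\lambda,\pi_{y^\delta}).$$
   Context: Setting: $\mathcal{A}:\mathbb{R}^n\to\mathbb{R}^k$ is a linear operator. $\pi_x$ is a (Borel) probability measure on $\mathbb{R}^n$ and, for each $\delta\ge 0$, $\pi_{y^\delta}$ is a (Borel) probability measure on $\mathbb{R}^k$. The expectation $\mathbb{E}_{\pi_{y^\delta}}$ is over $y^\delta\sim\pi_{y^\delta}$. $\{\mathcal{G}_\phi\}_{\phi}$ is a family of measurable maps $\mathcal{G}_\phi:\mathbb{R}^k\to\mathbb{R}^n$. (The dimension $n$ is unrelated to the sequence index $n$.) Assumptions: (A1) $\pi_x$ is compactly supported, and there is a compact set $\mathcal{K}\subset\mathbb{R}^k$ such that $\pi_{y^\delta}$ is supported on $\mathcal{K}$ for every $\delta\ge0$. (A2) The parameter $\phi$ ranges over a (nonempty) compact subset $K$ of a finite-dimensional space. (A3) $\mathcal{G}_{\phi_n}\to\mathcal{G}_\phi$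 pointwise whenever $\phi_n\to\phi$ in $K$. (A4) $\sup_{\phi\in K}\|\mathcal{G}_\phi\|_\infty<\infty$, where $\|\cdot\|_\infty$ is the supremum norm. Notation: $T_\#\pi$ denotes the push-forward of $\pi$ by $T$. $\mathbb{W}_1(\pi_1,\pi_2)=\inf_{\mu\in\Pi(\pi_1,\pi_2)}\int\|x_1-x_2\|_2\,\mathrm{d}\mu(x_1,x_2)$ is the Wasserstein-1 distance, where $\Pi(\pi_1,\pi_2)$ is the set of couplings of $\pi_1$ and $\pi_2$. $$J_2(\mathcal{G}_\phi|\lambda,\pi_{y^\delta}):=\mathbb{E}_{\pi_{y^\delta}}\|y^\delta-\mathcal{A}\mathcal{G}_\phi(y^\delta)\|_2^2+\lambda\,\mathbb{W}_1(\pi_x,(\mathcal{G}_\phi)_\#\pi_{y^\delta}).$$ *)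

theory Defs
  imports "HOL-Probability.Probability"
begin

definition supported_on :: "'a measure \<Rightarrow> 'a set \<Rightarrow> bool" where
  "supported_on M S \<longleftrightarrow> (AE x in M. x \<in> S)"

definition sup_norm :: "('a \<Rightarrow> 'b::real_normed_vector) \<Rightarrow> ennreal" where
  "sup_norm f = (SUP x. ennreal (norm (f x)))"

(* Only meaningful for finite measures with the same sigma-algebra. *)
definition tv_dist :: "'a measure \<Rightarrow> 'a measure \<Rightarrow> real" where
  "tv_dist M N = (SUP A\<in>sets M. \<bar>measure M A - measure N A\<bar>)"

definition couplings :: "'a measure \<Rightarrow> 'b measure \<Rightarrow> ('a \<times> 'b) measure set" where
  "couplings M N =
     {\<mu>. prob_space \<mu> \<and> sets \<mu> = sets (M \<Otimes>\<^sub>M N) \<and> distr \<mu> M fst = M \<and> distr \<mu> N snd = N}"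

definition wasserstein1 ::
  "'a::euclidean_space measure \<Rightarrow> 'a measure \<Rightarrow> ennreal" where
  "wasserstein1 M N = (INF \<mu>\<in>couplings M N. \<integral>\<^sup>+ z. ennreal (norm (fst z - snd z)) \<partial>\<mu>)"

(* The norm on real ^ 'n is the Euclidean norm. The functional takes values in [0, \<infinity>],
   so it is well defined without any integrability assumption. *)
definition J2 ::
  "(real ^ 'n \<Rightarrow> real ^ 'k) \<Rightarrow> (real ^ 'n) measure \<Rightarrow> (real ^ 'k \<Rightarrow> real ^ 'n) \<Rightarrow> real
     \<Rightarrow> (real ^ 'k) measure \<Rightarrow> ennreal" where
  "J2 A \<pi>x g lam \<pi>y =
     (\<integral>\<^sup>+ y. ennreal ((norm (y - A (g y)))\<^sup>2) \<partial>\<pi>y)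
     + ennreal lam * wasserstein1 \<pi>x (distr \<pi>y borel g)"

end

theory Submission
  imports Defs
begin

text \<open>
  The functional \<open>J\<^sub>2\<close> is sequentially continuous along \<open>(p\<^sub>n, \<delta>\<^sub>n) \<rightarrow> (p, \<delta>)\<close>, so that a limit point of
  minimisers is a minimiser. For the fidelity term, a layer-cake estimate bounds the change of the
  measure by the total variation and dominated convergence handles the change of the integrand.
  For the Wasserstein term, the triangle inequality reduces the claim to
  \<open>W\<^sub>1(g\<^sub>n # Q, g # Q) \<le> \<integral> |g\<^sub>n - g| dQ\<close> and \<open>W\<^sub>1(g\<^sub>n # P\<^sub>n, g\<^sub>n # Q) \<le> 2 R TV(P\<^sub>n, Q)\<close>. Couplings
  are built as densities with respect to product measures that depend only on the cells of a finite
  partition of small diameter.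
\<close>

section \<open>Finite partitions and functions of the cell label\<close>

text \<open>By total boundedness, finitely many balls of radius \<open>e/2\<close> cover
  \<open>S\<close>. Labelling a point by the first ball that contains it makes the cells disjoint,
  and two points of one ball are closer than \<open>e\<close>. Since the labels are finitely many
  natural numbers, integrals of functions of the label turn into finite sums.\<close>

lemma compact_finite_cells:
  fixes S :: "'a::metric_space set"
  assumes "compact S" and "e > 0"
  obtains c :: "'a \<Rightarrow> nat" and N where
    "c \<in> borel \<rightarrow>\<^sub>M count_space UNIV" and "\<And>z. c z < N"
    and "\<And>z z'. z \<in> S \<Longrightarrow> z' \<in> S \<Longrightarrow> c z = c z' \<Longrightarrow> dist z z' < e"
proof -
  have "e / 2 > 0"
    using assms(2) by simp
  then obtain k where k: "finite k" "S \<subseteq> (\<Union>x\<in>k. ball x (e/2))"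
    using assms(1) unfolding compact_eq_totally_bounded by blast
  obtain xs where xs: "set xs = k"
    using k(1) finite_list by blast
  \<comment> \<open>The disjunct \<open>length xs \<le> i\<close> gives every point outside all
    balls the default label \<open>length xs\<close>. Thus \<open>c\<close> is total and bounded,
    with \<open>N = Suc (length xs)\<close>; points of \<open>S\<close> never receive this
    label.\<close>
  define P where "P = (\<lambda>i z. length xs \<le> i \<or> dist (xs ! i) z < e/2)"
  define c where "c = (\<lambda>z. LEAST i. P i z)"
  have P_length: "P (length xs) z" for z
    by (simp add: P_def)
  have P: "P (c z) z" for z
    unfolding c_def by (rule LeastI[of "\<lambda>i. P i z", OF P_length])
  have c_le: "c z \<le> length xs" for z
    unfolding c_def by (rule Least_le[of "\<lambda>i. P i z", OF P_length])
  have P_pred: "Measurable.pred borel (P i)" for i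
  proof -
    have "{z. P i z} = (if length xs \<le> i then UNIV else ball (xs ! i) (e/2))"
      by (auto simp: P_def)
    then show ?thesis
      by (simp add: pred_def)
  qed
  have "c \<in> borel \<rightarrow>\<^sub>M count_space UNIV"
    unfolding c_def by (rule measurable_Least) (rule P_pred)
  moreover have "c z < Suc (length xs)" for z
    using c_le[of z] by simp
  moreover have "dist z z' < e" if z: "z \<in> S" "z' \<in> S" "c z = c z'" for z z'
  proof -
    obtain x where "x \<in> set xs" "dist x z < e/2"
      using k(2) z(1) xs by auto
    then obtain i where i: "i < length xs" "dist (xs ! i) z < e/2"
      by (auto simp: in_set_conv_nth)
    have "c z \<le> i"
      unfolding c_def by (rule Least_le) (use i in \<open>simp add: P_def\<close>)
    then have "c z < length xs"
      using i by simp
    then have "dist (xs ! c z) z < e/2" "dist (xs ! c z) z' < e/2"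
      using P[of z] P[of z'] z(3) by (auto simp: P_def)
    then show ?thesis
      by (metis dist_commute dist_triangle_half_r)
  qed
  ultimately show thesis
    using that by blast
qed

text \<open>There are only countably many labels, so the fibres of measure zero together form a null
  set. Densities that divide by the mass of a cell are therefore well behaved almost
  everywhere.\<close>

lemma AE_fiber_positive:
  assumes "prob_space M" and c[measurable]: "c \<in> M \<rightarrow>\<^sub>M count_space (UNIV :: nat set)"
  shows "AE x in M. measure M (c -` {c x} \<inter> space M) > 0"
proof -
  interpret prob_space M by fact
  have "AE x in M. \<not> (c x = i \<and> measure M (c -` {i} \<inter> space M) = 0)" for i
  proof (cases "measure M (c -` {i} \<inter> space M) = 0")
    case True
    then have "c -` {i} \<inter> space M \<in> null_sets M"
      by (auto simp: null_sets_def emeasure_eq_measure)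
    then show ?thesis
      by (rule AE_I') auto
  qed simp
  then have "AE x in M. \<forall>i. \<not> (c x = i \<and> measure M (c -` {i} \<inter> space M) = 0)"
    by (subst AE_all_countable) blast
  then show ?thesis
    by eventually_elim (auto simp: zero_less_measure_iff)
qed

lemma nn_integral_finite_valued:
  fixes f :: "nat \<Rightarrow> ennreal"
  assumes "prob_space M" and c[measurable]: "c \<in> M \<rightarrow>\<^sub>M count_space UNIV"
    and N: "\<And>x. c x < N"
  shows "(\<integral>\<^sup>+x. f (c x) \<partial>M) = (\<Sum>i<N. f i * ennreal (measure M (c -` {i} \<inter> space M)))"
proof -
  interpret prob_space M by fact
  have [measurable]: "c -` {i} \<inter> space M \<in> sets M" for i
    using measurable_sets[OF c] by simp
  have "(\<integral>\<^sup>+x. f (c x) \<partial>M) = (\<integral>\<^sup>+x. (\<Sum>i<N. f i * indicator (c -` {i} \<inter> space M) x) \<partial>M)"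
  proof (rule nn_integral_cong)
    fix x assume "x \<in> space M"
    then have "(\<Sum>i<N. f i * indicator (c -` {i} \<inter> space M) x) = (\<Sum>i<N. if c x = i then f i else 0)"
      by (intro sum.cong) (auto simp: indicator_def)
    then show "f (c x) = (\<Sum>i<N. f i * indicator (c -` {i} \<inter> space M) x)"
      using N[of x] by simp
  qed
  also have "\<dots> = (\<Sum>i<N. f i * ennreal (measure M (c -` {i} \<inter> space M)))"
    by (subst nn_integral_sum) (simp_all add: nn_integral_cmult_indicator emeasure_eq_measure)
  finally show ?thesis .
qed

lemma measurable_count_space_pair:
  fixes H :: "nat \<Rightarrow> nat \<Rightarrow> ennreal"
  assumes f: "f \<in> M \<rightarrow>\<^sub>M count_space UNIV" and g: "g \<in> M \<rightarrow>\<^sub>M count_space UNIV"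
  shows "(\<lambda>x. H (f x) (g x)) \<in> borel_measurable M"
proof (rule measurable_compose_countable[OF _ f])
  show "(\<lambda>x. H i (g x)) \<in> borel_measurable M" for i
    by (rule measurable_compose[OF g]) simp
qed

section \<open>Couplings with a density and the triangle inequality\<close>

text \<open>By Tonelli, integrating \<open>h\<close> over one variable gives the density of the
  other marginal. Asking for the value 1 only almost everywhere leaves room for cells of mass zero,
  where the densities used below integrate to 0.\<close>

lemma density_in_couplings:
  assumes "prob_space M" "prob_space N"
    and h[measurable]: "h \<in> borel_measurable (M \<Otimes>\<^sub>M N)"
    and hN: "AE x in M. (\<integral>\<^sup>+y. h (x, y) \<partial>N) = 1"
    and hM: "AE y in N. (\<integral>\<^sup>+x. h (x, y) \<partial>M) = 1"
  shows "density (M \<Otimes>\<^sub>M N) h \<in> couplings M N"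
proof -
  interpret M: prob_space M by fact
  interpret N: prob_space N by fact
  interpret pair_sigma_finite M N ..
  let ?D = "density (M \<Otimes>\<^sub>M N) h"
  have 1: "distr ?D M fst = M"
  proof (rule measure_eqI)
    fix A assume "A \<in> sets (distr ?D M fst)"
    then have A[measurable]: "A \<in> sets M" by simp
    have "emeasure (distr ?D M fst) A = (\<integral>\<^sup>+p. indicator A (fst p) \<partial>?D)"
      by (simp flip: nn_integral_indicator add: nn_integral_distr)
    also have "\<dots> = (\<integral>\<^sup>+p. h p * indicator A (fst p) \<partial>(M \<Otimes>\<^sub>M N))"
      by (subst nn_integral_density) auto
    also have "\<dots> = (\<integral>\<^sup>+x. \<integral>\<^sup>+y. h (x, y) * indicator A x \<partial>N \<partial>M)"
      by (subst N.nn_integral_fst[symmetric]) auto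
    also have "\<dots> = (\<integral>\<^sup>+x. (\<integral>\<^sup>+y. h (x, y) \<partial>N) * indicator A x \<partial>M)"
      by (intro nn_integral_cong nn_integral_multc) simp
    also have "\<dots> = (\<integral>\<^sup>+x. indicator A x \<partial>M)"
      by (intro nn_integral_cong_AE) (use hN in auto)
    finally show "emeasure (distr ?D M fst) A = emeasure M A"
      by simp
  qed simp
  have 2: "distr ?D N snd = N"
  proof (rule measure_eqI)
    fix A assume "A \<in> sets (distr ?D N snd)"
    then have A[measurable]: "A \<in> sets N" by simp
    have "emeasure (distr ?D N snd) A = (\<integral>\<^sup>+p. indicator A (snd p) \<partial>?D)"
      by (simp flip: nn_integral_indicator add: nn_integral_distr)
    also have "\<dots> = (\<integral>\<^sup>+p. h p * indicator A (snd p) \<partial>(M \<Otimes>\<^sub>M N))"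
      by (subst nn_integral_density) auto
    also have "\<dots> = (\<integral>\<^sup>+y. \<integral>\<^sup>+x. h (x, y) * indicator A y \<partial>M \<partial>N)"
      by (subst nn_integral_snd[symmetric]) auto
    also have "\<dots> = (\<integral>\<^sup>+y. (\<integral>\<^sup>+x. h (x, y) \<partial>M) * indicator A y \<partial>N)"
      by (intro nn_integral_cong nn_integral_multc) simp
    also have "\<dots> = (\<integral>\<^sup>+y. indicator A y \<partial>N)"
      by (intro nn_integral_cong_AE) (use hM in auto)
    finally show "emeasure (distr ?D N snd) A = emeasure N A"
      by simp
  qed simp
  \<comment> \<open>A push-forward keeps the total mass, so the first marginal already fixes the
    mass of the density.\<close>
  have "prob_space (distr ?D M fst)"
    unfolding 1 by fact
  then have "prob_space ?D"
    by (rule prob_space_distrD[rotated]) simp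
  with 1 2 show ?thesis
    by (simp add: couplings_def)
qed

text \<open>A push-forward depends on its target space only through the sigma-algebra. The marginals
  can therefore be computed over \<open>borel\<close> or a product of Borel spaces, instead of over
  the marginal measures that appear in \<open>couplings\<close>.\<close>

lemma couplingsD:
  assumes "\<mu> \<in> couplings M N" and sets: "sets M = sets M'" "sets N = sets N'"
  shows "prob_space \<mu>" "sets \<mu> = sets (M' \<Otimes>\<^sub>M N')"
    "distr \<mu> M' fst = M" "distr \<mu> N' snd = N"
  using assms sets_pair_measure_cong[OF sets] distr_cong[of \<mu> \<mu> M M' fst fst] distr_cong[of \<mu> \<mu> N N' snd snd]
  by (auto simp: couplings_def)

text \<open>
  Exact gluing of two couplings needs a disintegration along the middle marginal. Instead, cut the
  compact support of \<open>\<beta>\<close> into finitely many cells of diameter less than \<open>e\<close> and let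
  the two middle points be independent given that they lie in the same cell: the marginals are exact
  and the cost grows by at most \<open>e\<close>.
\<close>

lemma wasserstein1_le_add_cost:
  fixes \<alpha> \<beta> \<beta>' :: "'a::euclidean_space measure"
  assumes sets: "sets \<alpha> = sets borel" "sets \<beta> = sets borel" "sets \<beta>' = sets borel"
    and \<mu>: "\<mu> \<in> couplings \<alpha> \<beta>" and \<rho>: "\<rho> \<in> couplings \<beta> \<beta>'"
    and S: "compact S" "AE z in \<beta>. z \<in> S"
  shows "wasserstein1 \<alpha> \<beta>' \<le> (\<integral>\<^sup>+p. ennreal (norm (fst p - snd p)) \<partial>\<mu>)
    + (\<integral>\<^sup>+p. ennreal (norm (fst p - snd p)) \<partial>\<rho>)"
proof (rule ennreal_le_epsilon)
  fix e :: real assume "e > 0"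
  note [measurable_cong] = sets
  note \<mu>' = couplingsD[OF \<mu> sets(1,2)] and \<rho>' = couplingsD[OF \<rho> sets(2,3)]
  note [measurable_cong] = \<mu>'(2) \<rho>'(2)
  interpret \<mu>: prob_space \<mu> by fact
  interpret \<rho>: prob_space \<rho> by fact
  have \<beta>: "prob_space \<beta>"
    using \<mu>.prob_space_distr[of snd borel] \<mu>'(4) by simp
  then interpret \<beta>: prob_space \<beta> .
  have sp: "space \<beta> = UNIV" 
    using sets_eq_imp_space_eq[OF sets(2)] by simp
  obtain c :: "'a \<Rightarrow> nat" and N where c: "c \<in> borel \<rightarrow>\<^sub>M count_space UNIV" and "\<And>z. c z < N"
    and cell: "\<And>z z'. z \<in> S \<Longrightarrow> z' \<in> S \<Longrightarrow> c z = c z' \<Longrightarrow> dist z z' < e"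
    using compact_finite_cells[OF S(1) \<open>e > 0\<close>] by blast
  note [measurable] = c
  define q where "q = (\<lambda>i. measure \<beta> (c -` {i}))"
  have q_pos: "AE z in \<beta>. q (c z) > 0"
    using AE_fiber_positive[OF \<beta>, of c] by (simp add: q_def sp)
  \<comment> \<open>Relative to the product of \<mu> and \<rho>, this is the density of the gluing:
    the two middle points must share a cell, and dividing by the mass of that cell normalises the
    conditional law.\<close>
  define h where "h = (\<lambda>p :: ('a \<times> 'a) \<times> ('a \<times> 'a). if c (snd (fst p)) = c (fst (snd p))
    then ennreal (1 / q (c (snd (fst p)))) else 0)"
  have hm[measurable]: "h \<in> borel_measurable (\<mu> \<Otimes>\<^sub>M \<rho>)"
    unfolding h_def
    by (rule measurable_count_space_pair[where H="\<lambda>i j. if i = j then ennreal (1 / q i) else 0"])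
      (rule measurable_compose[OF _ c], measurable)+
  \<comment> \<open>Both marginal conditions for \<open>h\<close> reduce to this integral, because
    \<open>h\<close> sees only the labels of the middle points and the middle marginal is \<beta> on
    either side.\<close>
  have int_cell: "(\<integral>\<^sup>+z. (if i = c z then ennreal (1 / q i) else 0) \<partial>\<beta>) = 1" if "q i > 0" for i
  proof -
    have "(\<integral>\<^sup>+z. (if i = c z then ennreal (1 / q i) else 0) \<partial>\<beta>)
      = (\<integral>\<^sup>+z. ennreal (1 / q i) * indicator (c -` {i}) z \<partial>\<beta>)"
      by (intro nn_integral_cong) (auto simp: indicator_def)
    also have "\<dots> = ennreal (1 / q i) * ennreal (q i)"
      using measurable_sets[OF c, of "{i}"]
      by (subst nn_integral_cmult) (auto simp: q_def \<beta>.emeasure_eq_measure sets)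
    also have "\<dots> = 1"
      using that by (simp flip: ennreal_mult)
    finally show ?thesis .
  qed
  define D where "D = density (\<mu> \<Otimes>\<^sub>M \<rho>) h"
  have D: "D \<in> couplings \<mu> \<rho>"
    unfolding D_def
  proof (rule density_in_couplings)
    have "AE p in \<mu>. q (c (snd p)) > 0"
      by (rule AE_distrD[of snd \<mu> borel]) (use q_pos \<mu>'(4) in auto)
    then show "AE p in \<mu>. (\<integral>\<^sup>+r. h (p, r) \<partial>\<rho>) = 1"
    proof eventually_elim
      case (elim p)
      have "(\<integral>\<^sup>+r. h (p, r) \<partial>\<rho>)
        = (\<integral>\<^sup>+z. (if c (snd p) = c z then ennreal (1 / q (c (snd p))) else 0) \<partial>distr \<rho> borel fst)"
        by (subst nn_integral_distr) (auto simp: h_def intro!: nn_integral_cong)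
      then show ?case
        using int_cell[OF elim] \<rho>'(3) by simp
    qed
    have "AE p in \<rho>. q (c (fst p)) > 0"
      by (rule AE_distrD[of fst \<rho> borel]) (use q_pos \<rho>'(3) in auto)
    then show "AE r in \<rho>. (\<integral>\<^sup>+p. h (p, r) \<partial>\<mu>) = 1"
    proof eventually_elim
      case (elim r)
      have "(\<integral>\<^sup>+p. h (p, r) \<partial>\<mu>)
        = (\<integral>\<^sup>+z. (if c (fst r) = c z then ennreal (1 / q (c (fst r))) else 0) \<partial>distr \<mu> borel snd)"
        by (subst nn_integral_distr) (auto simp: h_def intro!: nn_integral_cong)
      then show ?case
        using int_cell[OF elim] \<mu>'(4) by simp
    qed
  qed fact+
  note D' = couplingsD[OF D \<mu>'(2) \<rho>'(2)]
  note [measurable_cong] = D'(2)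
  interpret D: prob_space D by fact
  have ae_cell: "AE p in D. c (snd (fst p)) = c (fst (snd p))"
    unfolding D_def by (subst AE_density[OF hm]) (auto simp: h_def)
  have ae1: "AE p in \<mu>. snd p \<in> S"
    by (rule AE_distrD[of snd \<mu> borel]) (use S \<mu>'(4) in auto)
  have ae2: "AE p in \<rho>. fst p \<in> S"
    by (rule AE_distrD[of fst \<rho> borel]) (use S \<rho>'(3) in auto)
  have ae3: "AE p in D. snd (fst p) \<in> S"
    by (rule AE_distrD[of fst D "borel \<Otimes>\<^sub>M borel"]) (use ae1 D'(3) in auto)
  have ae4: "AE p in D. fst (snd p) \<in> S"
    by (rule AE_distrD[of snd D "borel \<Otimes>\<^sub>M borel"]) (use ae2 D'(4) in auto)
  \<comment> \<open>The glued coupling forgets both middle points and keeps the outer ones.\<close>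
  define \<gamma> where "\<gamma> = distr D (borel \<Otimes>\<^sub>M borel) (\<lambda>p. (fst (fst p), snd (snd p)))"
  have "distr \<gamma> \<alpha> fst = distr (distr D (borel \<Otimes>\<^sub>M borel) fst) borel fst"
    unfolding \<gamma>_def by (subst (1 2) distr_distr) (auto simp: comp_def sets intro!: distr_cong)
  moreover have "distr \<gamma> \<beta>' snd = distr (distr D (borel \<Otimes>\<^sub>M borel) snd) borel snd"
    unfolding \<gamma>_def by (subst (1 2) distr_distr) (auto simp: comp_def sets intro!: distr_cong)
  moreover have "prob_space \<gamma>"
    unfolding \<gamma>_def by (rule D.prob_space_distr) measurable
  moreover have "sets \<gamma> = sets (\<alpha> \<Otimes>\<^sub>M \<beta>')"
    unfolding \<gamma>_def using sets_pair_measure_cong[OF sets(1,3)] by simp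
  ultimately have "\<gamma> \<in> couplings \<alpha> \<beta>'"
    unfolding couplings_def using D'(3,4) \<mu>'(3) \<rho>'(4) by simp
  then have "wasserstein1 \<alpha> \<beta>' \<le> (\<integral>\<^sup>+p. ennreal (norm (fst p - snd p)) \<partial>\<gamma>)"
    unfolding wasserstein1_def by (rule INF_lower)
  also have "\<dots> = (\<integral>\<^sup>+p. ennreal (norm (fst (fst p) - snd (snd p))) \<partial>D)"
    unfolding \<gamma>_def by (subst nn_integral_distr) auto
  \<comment> \<open>Travel from the first outer point through the two middle points to the last one.
    The middle leg stays in one cell inside \<open>S\<close>, hence is shorter than
    \<open>e\<close>.\<close>
  also have "\<dots> \<le> (\<integral>\<^sup>+p. (ennreal (norm (fst (fst p) - snd (fst p)))
      + ennreal (norm (fst (snd p) - snd (snd p)))) + ennreal e \<partial>D)"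
  proof (rule nn_integral_mono_AE)
    show "AE p in D. ennreal (norm (fst (fst p) - snd (snd p)))
      \<le> (ennreal (norm (fst (fst p) - snd (fst p)))
      + ennreal (norm (fst (snd p) - snd (snd p)))) + ennreal e"
      using ae_cell ae3 ae4
    proof eventually_elim
      case (elim p)
      have "dist (snd (fst p)) (fst (snd p)) < e"
        using cell elim by blast
      moreover have "dist (fst (fst p)) (snd (snd p)) \<le> dist (fst (fst p)) (snd (fst p))
        + dist (snd (fst p)) (fst (snd p)) + dist (fst (snd p)) (snd (snd p))"
        by (meson add_mono dist_triangle dual_order.trans order_refl)
      ultimately show ?case
        using \<open>e > 0\<close> by (simp add: dist_norm flip: ennreal_plus)
    qed
  qed
  also have "\<dots> = (\<integral>\<^sup>+p. ennreal (norm (fst (fst p) - snd (fst p))) \<partial>D)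
      + (\<integral>\<^sup>+p. ennreal (norm (fst (snd p) - snd (snd p))) \<partial>D) + ennreal e"
    by (simp add: nn_integral_add D.emeasure_space_1)
  also have "(\<integral>\<^sup>+p. ennreal (norm (fst (fst p) - snd (fst p))) \<partial>D)
      = (\<integral>\<^sup>+p. ennreal (norm (fst p - snd p)) \<partial>distr D (borel \<Otimes>\<^sub>M borel) fst)"
    by (subst nn_integral_distr) auto
  also have "(\<integral>\<^sup>+p. ennreal (norm (fst (snd p) - snd (snd p))) \<partial>D)
      = (\<integral>\<^sup>+p. ennreal (norm (fst p - snd p)) \<partial>distr D (borel \<Otimes>\<^sub>M borel) snd)"
    by (subst nn_integral_distr) auto
  finally show "wasserstein1 \<alpha> \<beta>' \<le> (\<integral>\<^sup>+p. ennreal (norm (fst p - snd p)) \<partial>\<mu>)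
    + (\<integral>\<^sup>+p. ennreal (norm (fst p - snd p)) \<partial>\<rho>) + ennreal e"
    using D'(3,4) by simp
qed

text \<open>Almost optimal couplings, each within \<open>e/2\<close> of its infimum, are glued along
  the compactly supported middle measure.\<close>

lemma wasserstein1_triangle:
  fixes \<alpha> \<beta> \<beta>' :: "'a::euclidean_space measure"
  assumes sets: "sets \<alpha> = sets borel" "sets \<beta> = sets borel" "sets \<beta>' = sets borel"
    and S: "compact S" "AE z in \<beta>. z \<in> S"
  shows "wasserstein1 \<alpha> \<beta>' \<le> wasserstein1 \<alpha> \<beta> + wasserstein1 \<beta> \<beta>'"
proof (rule ennreal_le_epsilon)
  fix e :: real
  assume fin: "wasserstein1 \<alpha> \<beta> + wasserstein1 \<beta> \<beta>' < top" and "0 < e"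
  \<comment> \<open>Finiteness makes these inequalities strict, and strictness is what yields
    couplings below the bound; in particular it excludes an infimum over the empty set, which is
    \<open>top\<close>.\<close>
  have "wasserstein1 \<alpha> \<beta> < wasserstein1 \<alpha> \<beta> + ennreal (e/2)"
       "wasserstein1 \<beta> \<beta>' < wasserstein1 \<beta> \<beta>' + ennreal (e/2)"
    using fin \<open>0 < e\<close> by (auto simp: ennreal_add_left_cancel_less[of _ 0, simplified] less_top)
  then obtain \<mu> \<rho> where \<mu>: "\<mu> \<in> couplings \<alpha> \<beta>" "\<rho> \<in> couplings \<beta> \<beta>'"
    and less: "(\<integral>\<^sup>+p. ennreal (norm (fst p - snd p)) \<partial>\<mu>) < wasserstein1 \<alpha> \<beta> + ennreal (e/2)"
      "(\<integral>\<^sup>+p. ennreal (norm (fst p - snd p)) \<partial>\<rho>) < wasserstein1 \<beta> \<beta>' + ennreal (e/2)"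
    unfolding wasserstein1_def[of \<alpha> \<beta>] wasserstein1_def[of \<beta> \<beta>'] INF_less_iff
    by (auto simp: wasserstein1_def)
  have "wasserstein1 \<alpha> \<beta>' \<le> (wasserstein1 \<alpha> \<beta> + ennreal (e/2)) + (wasserstein1 \<beta> \<beta>' + ennreal (e/2))"
    using wasserstein1_le_add_cost[OF sets \<mu> S] less by (meson add_mono less_imp_le order_trans)
  also have "\<dots> = wasserstein1 \<alpha> \<beta> + wasserstein1 \<beta> \<beta>' + (ennreal (e/2) + ennreal (e/2))"
    by (simp only: ac_simps)
  also have "ennreal (e/2) + ennreal (e/2) = ennreal e"
    using \<open>0 < e\<close> by (simp flip: ennreal_plus)
  finally show "wasserstein1 \<alpha> \<beta>' \<le> wasserstein1 \<alpha> \<beta> + wasserstein1 \<beta> \<beta>' + ennreal e" .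
qed

section \<open>Upper bounds for the Wasserstein distance\<close>

text \<open>The joint law of \<open>f\<close> and \<open>g\<close> under \<open>M\<close> is a
  coupling, and its cost is the right-hand side.\<close>

lemma wasserstein1_distr_le:
  fixes f g :: "'b \<Rightarrow> 'a::euclidean_space"
  assumes "prob_space M" and [measurable]: "f \<in> borel_measurable M" "g \<in> borel_measurable M"
  shows "wasserstein1 (distr M borel f) (distr M borel g) \<le> (\<integral>\<^sup>+x. ennreal (norm (f x - g x)) \<partial>M)"
proof -
  interpret prob_space M by fact
  let ?\<mu> = "distr M (borel \<Otimes>\<^sub>M borel) (\<lambda>x. (f x, g x))"
  have "prob_space ?\<mu>"
    by (rule prob_space_distr) measurable
  moreover have "sets ?\<mu> = sets (distr M borel f \<Otimes>\<^sub>M distr M borel g)"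
    unfolding sets_distr by (rule sets_pair_measure_cong) simp_all
  moreover have "distr ?\<mu> (distr M borel f) fst = distr M borel f"
    by (subst distr_distr) (auto simp: comp_def intro!: distr_cong)
  moreover have "distr ?\<mu> (distr M borel g) snd = distr M borel g"
    by (subst distr_distr) (auto simp: comp_def intro!: distr_cong)
  ultimately have "?\<mu> \<in> couplings (distr M borel f) (distr M borel g)"
    by (simp add: couplings_def)
  then have "wasserstein1 (distr M borel f) (distr M borel g) \<le> (\<integral>\<^sup>+p. ennreal (norm (fst p - snd p)) \<partial>?\<mu>)"
    unfolding wasserstein1_def by (rule INF_lower)
  then show ?thesis
    by (subst (asm) nn_integral_distr) auto
qed

text \<open>Discrete core of the total variation bound, for the cell masses \<open>p\<close> and
  \<open>q\<close>. The coupling is expressed by its density \<open>H\<close> with respect to the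
  product of \<open>p\<close> and \<open>q\<close>, because a density depending only on labels lifts
  from cells to measures. The last conclusion bounds the mass that has to change its cell.\<close>

lemma finite_coupling:
  fixes p q :: "nat \<Rightarrow> real"
  assumes nonneg: "\<And>i. p i \<ge> 0" "\<And>i. q i \<ge> 0"
    and sums: "(\<Sum>i<N. p i) = 1" "(\<Sum>i<N. q i) = 1"
    and T: "(\<Sum>i<N. p i - min (p i) (q i)) \<le> T"
  obtains H :: "nat \<Rightarrow> nat \<Rightarrow> real" where
    "\<And>i j. H i j \<ge> 0"
    and "\<And>i. i < N \<Longrightarrow> p i > 0 \<Longrightarrow> (\<Sum>j<N. H i j * q j) = 1"
    and "\<And>j. j < N \<Longrightarrow> q j > 0 \<Longrightarrow> (\<Sum>i<N. H i j * p i) = 1"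
    and "(\<Sum>i<N. (\<Sum>j<N. (if i = j then 0 else H i j) * q j) * p i) \<le> T"
proof -
  define m where "m = (\<lambda>i. min (p i) (q i))"
  define a where "a = (\<lambda>i. p i - m i)"
  define b where "b = (\<lambda>i. q i - m i)"
  define t where "t = (\<Sum>i<N. a i)"
  have a0: "a i \<ge> 0" and b0: "b i \<ge> 0" and m0: "m i \<ge> 0" for i
    using nonneg by (auto simp: a_def b_def m_def)
  have tb: "(\<Sum>i<N. b i) = t"
    unfolding t_def a_def b_def by (simp add: sum_subtractf sums)
  have t0: "t \<ge> 0"
    unfolding t_def by (intro sum_nonneg a0)
  have at: "a i * t / t = a i" and bt: "b i * t / t = b i" if "i < N" for i
  proof -
    have "a i = 0" if "t = 0"
      using that \<open>i < N\<close> a0 sum_nonneg_eq_0_iff[of "{..<N}" a] by (simp add: t_def)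
    moreover have "b i = 0" if "t = 0"
      using that \<open>i < N\<close> b0 sum_nonneg_eq_0_iff[of "{..<N}" b] by (simp add: tb)
    ultimately show "a i * t / t = a i" "b i * t / t = b i"
      by auto
  qed
  \<comment> \<open>Maximal coupling: keep the common mass in place, redistribute the excess proportionally. The
      divisions by zero are harmless: \<open>t = 0\<close> forces \<open>a = b = 0\<close>, and a cell of mass \<open>0\<close> has weight \<open>0\<close>.\<close>
  define w where "w = (\<lambda>i j. (if i = j then m i else 0) + a i * b j / t)"
  define H where "H = (\<lambda>i j. w i j / (p i * q j))"
  have w0: "w i j \<ge> 0" for i j
    unfolding w_def using a0 b0 m0 t0 by simp
  have w_p: "w i j = 0" if "p i = 0" for i j
    using that nonneg[of i] by (auto simp: w_def a_def m_def)
  have w_q: "w i j = 0" if "q j = 0" for i j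
    using that nonneg[of j] by (auto simp: w_def b_def m_def)
  have Hq: "H i j * q j = w i j / p i" for i j
    using w_q[of j i] by (cases "q j = 0") (auto simp: H_def)
  have Hp: "H i j * p i = w i j / q j" for i j
    using w_p[of i j] by (cases "p i = 0") (auto simp: H_def)
  show thesis
  proof
    show "H i j \<ge> 0" for i j
      unfolding H_def using w0 nonneg by simp
    show "(\<Sum>j<N. H i j * q j) = 1" if "i < N" "p i > 0" for i
    proof -
      have "(\<Sum>j<N. w i j) = m i + a i * (\<Sum>j<N. b j) / t"
        using that by (simp add: w_def sum.distrib sum_distrib_left sum_divide_distrib)
      also have "\<dots> = p i"
        using at that by (simp add: tb a_def)
      finally show ?thesis
        using that by (simp add: Hq flip: sum_divide_distrib)
    qed
    show "(\<Sum>i<N. H i j * p i) = 1" if "j < N" "q j > 0" for j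
    proof -
      have "(\<Sum>i<N. w i j) = m j + (\<Sum>i<N. a i) * b j / t"
        using that by (simp add: w_def sum.distrib sum_distrib_right sum_divide_distrib)
      also have "\<dots> = q j"
        using bt[OF that(1)] by (simp add: b_def mult.commute flip: t_def)
      finally show ?thesis
        using that by (simp add: Hp flip: sum_divide_distrib)
    qed
    have "(\<Sum>i<N. (\<Sum>j<N. (if i = j then 0 else H i j) * q j) * p i) \<le> (\<Sum>i<N. a i)"
    proof (rule sum_mono)
      fix i assume "i \<in> {..<N}"
      then have i: "i < N" by simp
      \<comment> \<open>Off the diagonal \<open>w i j\<close> is only the product term
        \<open>a i * b j / t\<close>; on the diagonal the left side is 0. Summing over
        \<open>j\<close> leaves the excess \<open>a i\<close>, relative to
        \<open>p i\<close>.\<close>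
      have "(\<Sum>j<N. (if i = j then 0 else H i j) * q j) \<le> (\<Sum>j<N. a i * b j / t / p i)"
        using a0 b0 t0 nonneg by (intro sum_mono) (auto simp: Hq w_def)
      also have "\<dots> = a i * t / t / p i"
        by (simp only: tb flip: sum_divide_distrib sum_distrib_left)
      also have "\<dots> = a i / p i"
        by (simp only: at[OF i])
      finally have "(\<Sum>j<N. (if i = j then 0 else H i j) * q j) * p i \<le> a i / p i * p i"
        by (rule mult_right_mono) (rule nonneg)
      also have "\<dots> \<le> a i"
        using a0[of i] by (cases "p i = 0") auto
      finally show "(\<Sum>j<N. (if i = j then 0 else H i j) * q j) * p i \<le> a i" .
    qed
    also have "\<dots> \<le> T"
      using T by (simp add: a_def m_def)
    finally show "(\<Sum>i<N. (\<Sum>j<N. (if i = j then 0 else H i j) * q j) * p i) \<le> T" .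
  qed
qed

lemma sum_ennreal_mult:
  fixes f g :: "'b \<Rightarrow> real"
  assumes "\<And>i. f i \<ge> 0" "\<And>i. g i \<ge> 0"
  shows "(\<Sum>i\<in>I. ennreal (f i) * ennreal (g i)) = ennreal (\<Sum>i\<in>I. f i * g i)"
proof -
  have "(\<Sum>i\<in>I. ennreal (f i) * ennreal (g i)) = (\<Sum>i\<in>I. ennreal (f i * g i))"
    using assms by (intro sum.cong refl) (simp add: ennreal_mult)
  then show ?thesis
    using assms by (simp add: sum_ennreal)
qed

text \<open>Mass that can stay in its cell moves by less than \<open>e\<close>; the remaining mass
  is at most \<open>T\<close> and moves by at most \<open>2 * R\<close>, the diameter of the ball
  that carries both measures.\<close>

lemma wasserstein1_le_total_variation:
  fixes \<alpha> \<beta> :: "'a::euclidean_space measure"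
  assumes prob: "prob_space \<alpha>" "prob_space \<beta>"
    and sets: "sets \<alpha> = sets borel" "sets \<beta> = sets borel"
    and R: "AE z in \<alpha>. norm z \<le> R" "AE z in \<beta>. norm z \<le> R"
    and T: "\<And>U. U \<in> sets borel \<Longrightarrow> measure \<alpha> U - measure \<beta> U \<le> T"
  shows "wasserstein1 \<alpha> \<beta> \<le> ennreal (2 * R * T)"
proof (rule ennreal_le_epsilon)
  fix e :: real assume "e > 0"
  note [measurable_cong] = sets
  interpret \<alpha>: prob_space \<alpha> by fact
  interpret \<beta>: prob_space \<beta> by fact
  have sp: "space \<alpha> = UNIV" "space \<beta> = UNIV"
    using sets[THEN sets_eq_imp_space_eq] by simp_all
  have "AE z in \<alpha>. 0 \<le> R"
    using R(1) by eventually_elim (use norm_ge_zero order_trans in blast)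
  then have R0: "R \<ge> 0"
    by simp
  have T0: "T \<ge> 0"
    using T[of "{}"] by simp
  obtain c :: "'a \<Rightarrow> nat" and N where c[measurable]: "c \<in> borel \<rightarrow>\<^sub>M count_space UNIV"
    and N: "\<And>z. c z < N"
    and cell: "\<And>z z'. z \<in> cball 0 R \<Longrightarrow> z' \<in> cball 0 R \<Longrightarrow> c z = c z' \<Longrightarrow> dist z z' < e"
    using compact_finite_cells[OF compact_cball \<open>e > 0\<close>] by blast
  have c\<alpha>[measurable]: "c \<in> \<alpha> \<rightarrow>\<^sub>M count_space UNIV" and c\<beta>[measurable]: "c \<in> \<beta> \<rightarrow>\<^sub>M count_space UNIV"
    by measurable
  define p where "p = (\<lambda>i. measure \<alpha> (c -` {i}))"
  define q where "q = (\<lambda>i. measure \<beta> (c -` {i}))"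
  have fiber: "c -` I \<in> sets borel" for I
    using measurable_sets[OF c, of I] by simp
  have int_\<alpha>: "(\<integral>\<^sup>+z. f (c z) \<partial>\<alpha>) = (\<Sum>i<N. f i * ennreal (p i))" for f
    using nn_integral_finite_valued[OF prob(1) c\<alpha> N, of f] by (simp add: p_def sp)
  have int_\<beta>: "(\<integral>\<^sup>+z. f (c z) \<partial>\<beta>) = (\<Sum>i<N. f i * ennreal (q i))" for f
    using nn_integral_finite_valued[OF prob(2) c\<beta> N, of f] by (simp add: q_def sp)
  have pos: "AE z in \<alpha>. p (c z) > 0" "AE z in \<beta>. q (c z) > 0"
    using AE_fiber_positive[OF prob(1) c\<alpha>] AE_fiber_positive[OF prob(2) c\<beta>]
    by (simp_all add: p_def q_def sp)
  have pq0: "p i \<ge> 0" "q i \<ge> 0" for i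
    by (simp_all add: p_def q_def)
  have sum1: "(\<Sum>i<N. p i) = 1" "(\<Sum>i<N. q i) = 1"
    using int_\<alpha>[of "\<lambda>_. 1"] int_\<beta>[of "\<lambda>_. 1"] pq0
    by (simp_all add: \<alpha>.emeasure_space_1 \<beta>.emeasure_space_1 sum_ennreal)
  have sumT: "(\<Sum>i<N. p i - min (p i) (q i)) \<le> T"
  proof -
    \<comment> \<open>Collecting all cells where \<open>p\<close> exceeds \<open>q\<close> into a
      single set lets the hypothesis on \<open>T\<close> be applied once, so the error does not grow
      with the number of cells.\<close>
    define I where "I = {i. i < N \<and> p i > q i}"
    have meas_I: "measure \<alpha> (c -` I) = (\<Sum>i\<in>I. p i)" "measure \<beta> (c -` I) = (\<Sum>i\<in>I. q i)"
    proof -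
      have I: "c -` I = (\<Union>i\<in>I. c -` {i})" "finite I"
        by (auto simp: I_def)
      show "measure \<alpha> (c -` I) = (\<Sum>i\<in>I. p i)" "measure \<beta> (c -` I) = (\<Sum>i\<in>I. q i)"
        unfolding I(1) p_def q_def using I(2) fiber
        by (auto intro!: \<alpha>.finite_measure_finite_Union \<beta>.finite_measure_finite_Union
            simp: sets disjoint_family_on_def)
    qed
    have "(\<Sum>i<N. p i - min (p i) (q i)) = (\<Sum>i\<in>I. p i - q i)"
      by (rule sum.mono_neutral_cong_right) (auto simp: I_def)
    also have "\<dots> = measure \<alpha> (c -` I) - measure \<beta> (c -` I)"
      by (simp add: meas_I sum_subtractf)
    also have "\<dots> \<le> T"
      by (rule T) (rule fiber)
    finally show ?thesis .
  qed
  obtain H where H0: "\<And>i j. H i j \<ge> 0"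
    and Hq: "\<And>i. i < N \<Longrightarrow> p i > 0 \<Longrightarrow> (\<Sum>j<N. H i j * q j) = 1"
    and Hp: "\<And>j. j < N \<Longrightarrow> q j > 0 \<Longrightarrow> (\<Sum>i<N. H i j * p i) = 1"
    and HT: "(\<Sum>i<N. (\<Sum>j<N. (if i = j then 0 else H i j) * q j) * p i) \<le> T"
    using finite_coupling[OF pq0 sum1 sumT] by blast
  have cf: "(\<lambda>x. c (fst x)) \<in> \<alpha> \<Otimes>\<^sub>M \<beta> \<rightarrow>\<^sub>M count_space UNIV" "(\<lambda>x. c (snd x)) \<in> \<alpha> \<Otimes>\<^sub>M \<beta> \<rightarrow>\<^sub>M count_space UNIV"
    by measurable
  define h where "h = (\<lambda>x. ennreal (H (c (fst x)) (c (snd x))))"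
  \<comment> \<open>The part of \<open>h\<close> that changes the cell: it will carry the cost
    \<open>2 * R\<close>, while \<open>h\<close> itself carries the cost \<open>e\<close>.\<close>
  define g where "g = (\<lambda>x. ennreal (if c (fst x) = c (snd x) then 0 else H (c (fst x)) (c (snd x))))"
  have h[measurable]: "h \<in> borel_measurable (\<alpha> \<Otimes>\<^sub>M \<beta>)"
    unfolding h_def by (rule measurable_count_space_pair[OF cf])
  have g[measurable]: "g \<in> borel_measurable (\<alpha> \<Otimes>\<^sub>M \<beta>)"
    unfolding g_def
    by (rule measurable_count_space_pair[OF cf, of "\<lambda>i j. ennreal (if i = j then 0 else H i j)"])
  define \<gamma> where "\<gamma> = density (\<alpha> \<Otimes>\<^sub>M \<beta>) h"
  have \<gamma>: "\<gamma> \<in> couplings \<alpha> \<beta>"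
    unfolding \<gamma>_def
  proof (rule density_in_couplings[OF prob h])
    show "AE x in \<alpha>. (\<integral>\<^sup>+y. h (x, y) \<partial>\<beta>) = 1"
      using pos(1)
    proof eventually_elim
      case (elim x)
      have "(\<integral>\<^sup>+y. h (x, y) \<partial>\<beta>) = (\<Sum>j<N. ennreal (H (c x) j) * ennreal (q j))"
        using int_\<beta>[of "\<lambda>j. ennreal (H (c x) j)"] by (simp add: h_def)
      also have "\<dots> = ennreal (\<Sum>j<N. H (c x) j * q j)"
        using H0 pq0 by (intro sum_ennreal_mult)
      finally show ?case
        using Hq[OF N elim] by simp
    qed
    show "AE y in \<beta>. (\<integral>\<^sup>+x. h (x, y) \<partial>\<alpha>) = 1"
      using pos(2)
    proof eventually_elim
      case (elim y)
      have "(\<integral>\<^sup>+x. h (x, y) \<partial>\<alpha>) = (\<Sum>i<N. ennreal (H i (c y)) * ennreal (p i))"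
        using int_\<alpha>[of "\<lambda>i. ennreal (H i (c y))"] by (simp add: h_def)
      also have "\<dots> = ennreal (\<Sum>i<N. H i (c y) * p i)"
        using H0 pq0 by (intro sum_ennreal_mult)
      finally show ?case
        using Hp[OF N elim] by simp
    qed
  qed
  note \<gamma>' = couplingsD[OF \<gamma> sets]
  interpret \<gamma>: prob_space \<gamma> by fact
  have int_h: "(\<integral>\<^sup>+x. h x \<partial>(\<alpha> \<Otimes>\<^sub>M \<beta>)) = 1"
    using \<gamma>.emeasure_space_1 unfolding \<gamma>_def by (simp add: emeasure_density cong: nn_integral_cong)
  have int_g: "(\<integral>\<^sup>+x. g x \<partial>(\<alpha> \<Otimes>\<^sub>M \<beta>)) \<le> ennreal T"
  proof -
    have "(\<integral>\<^sup>+x. g x \<partial>(\<alpha> \<Otimes>\<^sub>M \<beta>)) = (\<integral>\<^sup>+x. \<integral>\<^sup>+y. g (x, y) \<partial>\<beta> \<partial>\<alpha>)"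
      by (rule \<beta>.nn_integral_fst[symmetric]) (rule g)
    also have "\<dots> = (\<integral>\<^sup>+x. (\<Sum>j<N. ennreal (if c x = j then 0 else H (c x) j) * ennreal (q j)) \<partial>\<alpha>)"
    proof (rule nn_integral_cong)
      show "(\<integral>\<^sup>+y. g (x, y) \<partial>\<beta>) = (\<Sum>j<N. ennreal (if c x = j then 0 else H (c x) j) * ennreal (q j))" for x
        using int_\<beta>[of "\<lambda>j. ennreal (if c x = j then 0 else H (c x) j)"] unfolding g_def fst_conv snd_conv .
    qed
    also have "\<dots> = (\<Sum>i<N. (\<Sum>j<N. ennreal (if i = j then 0 else H i j) * ennreal (q j)) * ennreal (p i))"
      by (rule int_\<alpha>)
    also have "\<dots> = ennreal (\<Sum>i<N. (\<Sum>j<N. (if i = j then 0 else H i j) * q j) * p i)"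
    proof -
      have inner: "0 \<le> (if i = j then 0 else H i j)" for i j
        using H0 by simp
      have outer: "0 \<le> (\<Sum>j<N. (if i = j then 0 else H i j) * q j)" for i
        by (intro sum_nonneg mult_nonneg_nonneg inner pq0)
      show ?thesis
        by (simp only: sum_ennreal_mult[OF inner pq0(2)] sum_ennreal_mult[OF outer pq0(1)])
    qed
    also have "\<dots> \<le> ennreal T"
      using HT by (rule ennreal_leI)
    finally show ?thesis .
  qed
  note [measurable_cong] = \<gamma>'(2)
  have "AE x in \<gamma>. norm (fst x) \<le> R"
    by (rule AE_distrD[of fst \<gamma> borel]) (use R \<gamma>'(3) in auto)
  moreover have "AE x in \<gamma>. norm (snd x) \<le> R"
    by (rule AE_distrD[of snd \<gamma> borel]) (use R \<gamma>'(4) in auto)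
  ultimately have "AE x in \<gamma>. norm (fst x) \<le> R \<and> norm (snd x) \<le> R"
    by eventually_elim simp
  \<comment> \<open>The cost is estimated pointwise under the product measure, so the norm bounds
    are moved there from \<gamma>, restricted to where the density is positive.\<close>
  then have ae: "AE x in \<alpha> \<Otimes>\<^sub>M \<beta>. 0 < h x \<longrightarrow> norm (fst x) \<le> R \<and> norm (snd x) \<le> R"
    unfolding \<gamma>_def AE_density[OF h] .
  have "wasserstein1 \<alpha> \<beta> \<le> (\<integral>\<^sup>+x. ennreal (norm (fst x - snd x)) \<partial>\<gamma>)"
    unfolding wasserstein1_def by (rule INF_lower) (rule \<gamma>)
  also have "\<dots> = (\<integral>\<^sup>+x. h x * ennreal (norm (fst x - snd x)) \<partial>(\<alpha> \<Otimes>\<^sub>M \<beta>))"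
    unfolding \<gamma>_def by (subst nn_integral_density) auto
  also have "\<dots> \<le> (\<integral>\<^sup>+x. ennreal (2 * R) * g x + ennreal e * h x \<partial>(\<alpha> \<Otimes>\<^sub>M \<beta>))"
  proof (rule nn_integral_mono_AE)
    show "AE x in \<alpha> \<Otimes>\<^sub>M \<beta>. h x * ennreal (norm (fst x - snd x)) \<le> ennreal (2 * R) * g x + ennreal e * h x"
      using ae
    proof eventually_elim
      case (elim x)
      consider "h x = 0" | "norm (fst x) \<le> R" "norm (snd x) \<le> R"
        using elim by (cases "h x = 0") (auto simp: zero_less_iff_neq_zero)
      then show ?case
      proof cases
        case 1
        then show ?thesis by simp
      next
        case R: 2
        show ?thesis
        proof (cases "c (fst x) = c (snd x)")
          case True
          then have "norm (fst x - snd x) < e"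
            using cell[of "fst x" "snd x"] R by (simp add: dist_norm)
          then have "ennreal (norm (fst x - snd x)) * h x \<le> ennreal e * h x"
            by (intro mult_right_mono ennreal_leI) auto
          then show ?thesis
            by (simp add: mult.commute add_increasing)
        next
          case False
          then have "g x = h x"
            by (simp add: g_def h_def)
          have "norm (fst x - snd x) \<le> 2 * R"
            using R norm_triangle_ineq4[of "fst x" "snd x"] by linarith
          then have "ennreal (norm (fst x - snd x)) * h x \<le> ennreal (2 * R) * g x"
            unfolding \<open>g x = h x\<close> by (intro mult_right_mono ennreal_leI) auto
          then show ?thesis
            by (simp add: mult.commute add_increasing2)
        qed
      qed
    qed
  qed
  also have "\<dots> = ennreal (2 * R) * (\<integral>\<^sup>+x. g x \<partial>(\<alpha> \<Otimes>\<^sub>M \<beta>)) + ennreal e"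
    by (simp add: nn_integral_add nn_integral_cmult int_h)
  also have "\<dots> \<le> ennreal (2 * R) * ennreal T + ennreal e"
    using int_g by (intro add_mono mult_left_mono) auto
  also have "\<dots> = ennreal (2 * R * T) + ennreal e"
    using R0 T0 by (subst ennreal_mult[symmetric]) auto
  finally show "wasserstein1 \<alpha> \<beta> \<le> ennreal (2 * R * T) + ennreal e" .
qed

section \<open>Convergence under total variation\<close>

text \<open>Layer cake: the integral is that of the measures of the superlevel sets over levels in
  \<open>{0..B}\<close>. Each such measure changes by at most \<open>T\<close>, and the range of
  levels has length \<open>B\<close>.\<close>

lemma nn_integral_le_total_variation:
  fixes f :: "'a \<Rightarrow> real"
  assumes prob: "prob_space M" "prob_space N" and sets: "sets M = sets N"
    and f: "f \<in> borel_measurable N"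
    and B: "AE x in M. f x \<le> B" "B \<ge> 0"
    and T: "\<And>U. U \<in> sets N \<Longrightarrow> measure M U - measure N U \<le> T"
  shows "(\<integral>\<^sup>+x. ennreal (f x) \<partial>M) \<le> (\<integral>\<^sup>+x. ennreal (f x) \<partial>N) + ennreal (B * T)"
proof -
  interpret M: prob_space M by fact
  interpret N: prob_space N by fact
  note [measurable_cong] = sets
  note [measurable] = f
  \<comment> \<open>The bound by \<open>B\<close> holds only almost everywhere under
    \<open>M\<close>. Truncating makes it pointwise, leaves the integral under \<open>M\<close>
    unchanged and can only lower the one under \<open>N\<close>.\<close>
  define u where "u = (\<lambda>x. min (f x) B)"
  have u[measurable]: "u \<in> borel_measurable N"
    unfolding u_def by measurable
  have T0: "T \<ge> 0"
    using T[of "{}"] by simp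
  define U where "U = (\<lambda>s. {x \<in> space N. s < u x})"
  have U: "U s \<in> sets N" for s
    unfolding U_def by measurable
  have layer: "(\<integral>\<^sup>+x. ennreal (u x) \<partial>P) = (\<integral>\<^sup>+s. emeasure P (U s) * indicator {0..B} s \<partial>lborel)"
    if "prob_space P" "sets P = sets N" for P
  proof -
    interpret P: prob_space P by fact
    interpret pair_sigma_finite P lborel ..
    note [measurable_cong] = that(2)
    have sp': "space P = space N"
      using that(2) by (rule sets_eq_imp_space_eq)
    have "(\<integral>\<^sup>+x. ennreal (u x) \<partial>P) = (\<integral>\<^sup>+x. \<integral>\<^sup>+s. indicator {0..<u x} s \<partial>lborel \<partial>P)"
    proof (rule nn_integral_cong)
      show "ennreal (u x) = (\<integral>\<^sup>+s. indicator {0..<u x} s \<partial>lborel)" for x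
        by (cases "0 \<le> u x") (simp_all add: ennreal_neg)
    qed
    also have "\<dots> = (\<integral>\<^sup>+x. \<integral>\<^sup>+s. (if 0 \<le> s \<and> s < u x then 1 else 0) \<partial>lborel \<partial>P)"
      by (intro nn_integral_cong) (auto simp: indicator_def)
    also have "\<dots> = (\<integral>\<^sup>+s. \<integral>\<^sup>+x. (if 0 \<le> s \<and> s < u x then 1 else 0) \<partial>P \<partial>lborel)"
      by (rule Fubini'[symmetric]) measurable
    also have "\<dots> = (\<integral>\<^sup>+s. \<integral>\<^sup>+x. indicator (U s) x * indicator {0..B} s \<partial>P \<partial>lborel)"
      by (intro nn_integral_cong) (auto simp: indicator_def U_def u_def sp')
    also have "\<dots> = (\<integral>\<^sup>+s. emeasure P (U s) * indicator {0..B} s \<partial>lborel)"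
      using U that(2) by (intro nn_integral_cong) (simp add: nn_integral_multc)
    finally show ?thesis .
  qed
  have meas: "(\<lambda>s. emeasure N (U s)) \<in> borel_measurable lborel"
    unfolding U_def by measurable
  have "(\<integral>\<^sup>+x. ennreal (f x) \<partial>M) = (\<integral>\<^sup>+x. ennreal (u x) \<partial>M)"
    using B(1) by (intro nn_integral_cong_AE) (auto simp: u_def min_def)
  also have "\<dots> = (\<integral>\<^sup>+s. emeasure M (U s) * indicator {0..B} s \<partial>lborel)"
    by (rule layer[OF prob(1) sets])
  also have "\<dots> \<le> (\<integral>\<^sup>+s. emeasure N (U s) * indicator {0..B} s + ennreal T * indicator {0..B} s \<partial>lborel)"
  proof (rule nn_integral_mono)
    fix s :: real
    have "emeasure M (U s) \<le> emeasure N (U s) + ennreal T"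
      using T[OF U, of s] T0 by (simp add: M.emeasure_eq_measure N.emeasure_eq_measure flip: ennreal_plus)
    then show "emeasure M (U s) * indicator {0..B} s
        \<le> emeasure N (U s) * indicator {0..B} s + ennreal T * indicator {0..B} s"
      by (simp add: indicator_def)
  qed
  also have "\<dots> = (\<integral>\<^sup>+s. emeasure N (U s) * indicator {0..B} s \<partial>lborel) + ennreal T * ennreal B"
    using meas B(2) by (simp add: nn_integral_add nn_integral_cmult_indicator)
  also have "(\<integral>\<^sup>+s. emeasure N (U s) * indicator {0..B} s \<partial>lborel) = (\<integral>\<^sup>+x. ennreal (u x) \<partial>N)"
    by (rule layer[OF prob(2) refl, symmetric])
  also have "(\<integral>\<^sup>+x. ennreal (u x) \<partial>N) + ennreal T * ennreal B
      \<le> (\<integral>\<^sup>+x. ennreal (f x) \<partial>N) + ennreal T * ennreal B"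
    by (intro add_right_mono nn_integral_mono ennreal_leI) (simp add: u_def)
  finally show ?thesis
    using T0 B(2) by (simp add: ennreal_mult mult.commute[of "ennreal T"])
qed

text \<open>The supremum in \<open>tv_dist\<close> is a real one and dominates its members once they
  are bounded; for probability measures 1 is a bound.\<close>

lemma abs_measure_diff_le_tv_dist:
  assumes "prob_space M" "prob_space N" and "U \<in> sets M"
  shows "\<bar>measure M U - measure N U\<bar> \<le> tv_dist M N"
proof -
  interpret M: prob_space M by fact
  interpret N: prob_space N by fact
  have "\<bar>measure M A - measure N A\<bar> \<le> 1" for A
    using M.prob_le_1[of A] N.prob_le_1[of A] measure_nonneg[of M A] measure_nonneg[of N A] by linarith
  then have "bdd_above ((\<lambda>A. \<bar>measure M A - measure N A\<bar>) ` sets M)"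
    by (intro bdd_aboveI2)
  then show ?thesis
    unfolding tv_dist_def using assms(3) by (rule cSUP_upper2[OF _ _ order_refl])
qed

text \<open>A sandwich argument that stays in \<open>ennreal\<close> and so admits an infinite
  limit. Two one-sided inequalities stand in for a bound on the distance, and finiteness of
  \<open>e n\<close> permits moving it across by truncated subtraction.\<close>

lemma tendsto_ennreal_perturbed:
  fixes f g :: "nat \<Rightarrow> ennreal"
  assumes "\<And>n. f n \<le> g n + e n" "\<And>n. g n \<le> f n + e n" "\<And>n. e n < \<infinity>"
    and "g \<longlonglongrightarrow> l" "e \<longlonglongrightarrow> 0"
  shows "f \<longlonglongrightarrow> l"
proof (rule tendsto_sandwich)
  show "(\<lambda>n. g n - e n) \<longlonglongrightarrow> l"
    using tendsto_diff_ennreal_general[OF assms(4,5)] by simp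
  show "(\<lambda>n. g n + e n) \<longlonglongrightarrow> l"
    using tendsto_add[OF assms(4,5)] by simp
  show "\<forall>\<^sub>F n in sequentially. g n - e n \<le> f n"
  proof (intro always_eventually allI)
    show "g n - e n \<le> f n" for n
      using assms(2,3)[of n] by (auto simp: ennreal_minus_le_iff add.commute)
  qed
  show "\<forall>\<^sub>F n in sequentially. f n \<le> g n + e n"
    using assms(1) by simp
qed

text \<open>The measure is exchanged first, with \<open>f n\<close> held fixed; dominated
  convergence then takes place under the single measure \<open>Q\<close>.\<close>

lemma nn_integral_tendsto_total_variation:
  fixes f :: "nat \<Rightarrow> 'a \<Rightarrow> real" and f' :: "'a \<Rightarrow> real"
  assumes prob: "\<And>n. prob_space (P n)" "prob_space Q" and sets: "\<And>n. sets (P n) = sets Q"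
    and meas: "\<And>n. f n \<in> borel_measurable Q" "f' \<in> borel_measurable Q"
    and B: "\<And>n. AE x in P n. f n x \<le> B" "\<And>n. AE x in Q. f n x \<le> B" "B \<ge> 0"
    and lim: "\<And>x. (\<lambda>n. f n x) \<longlonglongrightarrow> f' x"
    and tv: "(\<lambda>n. tv_dist (P n) Q) \<longlonglongrightarrow> 0"
  shows "(\<lambda>n. \<integral>\<^sup>+x. ennreal (f n x) \<partial>P n) \<longlonglongrightarrow> (\<integral>\<^sup>+x. ennreal (f' x) \<partial>Q)"
proof (rule tendsto_ennreal_perturbed)
  interpret Q: prob_space Q by fact
  have T: "\<bar>measure (P n) U - measure Q U\<bar> \<le> tv_dist (P n) Q" if "U \<in> sets Q" for n U
    using abs_measure_diff_le_tv_dist[OF prob(1)[of n] prob(2)] that sets by simp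
  show "(\<integral>\<^sup>+x. ennreal (f n x) \<partial>P n) \<le> (\<integral>\<^sup>+x. ennreal (f n x) \<partial>Q) + ennreal (B * tv_dist (P n) Q)" for n
    by (rule nn_integral_le_total_variation[OF prob sets meas(1) B(1,3)]) (use T abs_le_D1 in blast)
  show "(\<integral>\<^sup>+x. ennreal (f n x) \<partial>Q) \<le> (\<integral>\<^sup>+x. ennreal (f n x) \<partial>P n) + ennreal (B * tv_dist (P n) Q)" for n
  proof (rule nn_integral_le_total_variation[OF prob(2,1) sets[symmetric] _ B(2,3)])
    show "f n \<in> borel_measurable (P n)"
      using meas(1)[of n] measurable_cong_sets[OF sets refl] by blast
    show "measure Q U - measure (P n) U \<le> tv_dist (P n) Q" if "U \<in> sets (P n)" for U
      using T[of U n] that sets by fastforce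
  qed
  show "ennreal (B * tv_dist (P n) Q) < \<infinity>" for n
    by simp
  show "(\<lambda>n. \<integral>\<^sup>+x. ennreal (f n x) \<partial>Q) \<longlonglongrightarrow> (\<integral>\<^sup>+x. ennreal (f' x) \<partial>Q)"
  proof (rule nn_integral_dominated_convergence[where w = "\<lambda>_. ennreal B"])
    show "(\<integral>\<^sup>+x. ennreal B \<partial>Q) < \<infinity>"
      by (simp add: Q.emeasure_space_1)
    show "AE x in Q. ennreal (f n x) \<le> ennreal B" for n
      using B(2) by eventually_elim (rule ennreal_leI)
  qed (use meas lim in auto)
  show "(\<lambda>n. ennreal (B * tv_dist (P n) Q)) \<longlonglongrightarrow> 0"
    using tendsto_ennrealI[OF tendsto_mult_left[OF tv, of B]] by simp
qed

text \<open>The triangle inequality, used in both directions, controls the change by the distance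
  between the push-forwards. These live in a common ball, so the middle measure is always compactly
  supported.\<close>

lemma wasserstein1_tendsto_total_variation:
  fixes \<alpha> :: "'a::euclidean_space measure" and g :: "nat \<Rightarrow> 'b \<Rightarrow> 'a"
  assumes \<alpha>: "sets \<alpha> = sets borel"
    and prob: "\<And>n. prob_space (P n)" "prob_space Q" and sets: "\<And>n. sets (P n) = sets Q"
    and meas: "\<And>n. g n \<in> borel_measurable Q" "g' \<in> borel_measurable Q"
    and R: "\<And>n x. norm (g n x) \<le> R" "\<And>x. norm (g' x) \<le> R"
    and lim: "\<And>x. (\<lambda>n. g n x) \<longlonglongrightarrow> g' x"
    and tv: "(\<lambda>n. tv_dist (P n) Q) \<longlonglongrightarrow> 0"
  shows "(\<lambda>n. wasserstein1 \<alpha> (distr (P n) borel (g n))) \<longlonglongrightarrow> wasserstein1 \<alpha> (distr Q borel g')"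
proof -
  interpret Q: prob_space Q by fact
  note [measurable] = meas
  have measP[measurable]: "g n \<in> borel_measurable (P n)" for n
    using meas(1)[of n] measurable_cong_sets[OF sets refl] by blast
  \<comment> \<open>The intermediate \<open>?\<beta>'\<close> separates the two changes: from
    \<open>?\<beta>\<close> only the measure differs, from \<open>?\<gamma>\<close> only the
    map.\<close>
  let ?\<beta> = "\<lambda>n. distr (P n) borel (g n)" and ?\<beta>' = "\<lambda>n. distr Q borel (g n)" and ?\<gamma> = "distr Q borel g'"
  define d where "d = (\<lambda>n. \<integral>\<^sup>+x. ennreal (norm (g n x - g' x)) \<partial>Q)"
  define t where "t = (\<lambda>n. tv_dist (P n) Q)"
  have diff: "norm (g n x - g' x) \<le> 2 * R" for n x
    using norm_triangle_ineq4[of "g n x" "g' x"] R(1)[of n x] R(2)[of x] by linarith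
  have prob_distr: "prob_space (?\<beta> n)" "prob_space (?\<beta>' n)" for n
    by (rule prob_space.prob_space_distr[OF prob(1) measP] Q.prob_space_distr[OF meas(1)])+
  have cball: "AE z in ?\<beta> n. z \<in> cball 0 R" "AE z in ?\<beta>' n. z \<in> cball 0 R" "AE z in ?\<gamma>. z \<in> cball 0 R" for n
    using R by (simp_all add: AE_distr_iff)
  then have norm_R: "AE z in ?\<beta> n. norm z \<le> R" "AE z in ?\<beta>' n. norm z \<le> R" for n
    by simp_all
  \<comment> \<open>Events of the push-forwards are preimages under the same map, so pushing forward
    does not increase total variation.\<close>
  have T: "\<bar>measure (?\<beta> n) U - measure (?\<beta>' n) U\<bar> \<le> t n" if U: "U \<in> sets borel" for n U
  proof -
    have sp: "space (P n) = space Q"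
      using sets by (rule sets_eq_imp_space_eq)
    have "g n -` U \<inter> space Q \<in> sets (P n)"
      using measurable_sets[OF meas(1) U] sets by simp
    then show ?thesis
      unfolding t_def using abs_measure_diff_le_tv_dist[OF prob(1) prob(2)] U sp
      by (simp add: measure_distr)
  qed
  have "wasserstein1 (?\<beta> n) (?\<beta>' n) \<le> ennreal (2 * R * t n)" for n
    by (rule wasserstein1_le_total_variation[OF prob_distr _ _ norm_R]) (use T[of _ n] in \<open>auto simp: abs_le_iff\<close>)
  moreover have "wasserstein1 (?\<beta>' n) ?\<gamma> \<le> d n" for n
    unfolding d_def by (rule wasserstein1_distr_le[OF prob(2)]) measurable
  moreover have "wasserstein1 (?\<beta> n) ?\<gamma> \<le> wasserstein1 (?\<beta> n) (?\<beta>' n) + wasserstein1 (?\<beta>' n) ?\<gamma>" for n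
    by (rule wasserstein1_triangle[OF _ _ _ compact_cball cball(2)]) simp_all
  ultimately have to: "wasserstein1 (?\<beta> n) ?\<gamma> \<le> ennreal (2 * R * t n) + d n" for n
    by (meson add_mono order_trans)
  \<comment> \<open>The reversed distances are bounded directly, by the same two estimates, instead
    of through symmetry of \<open>wasserstein1\<close>.\<close>
  have "wasserstein1 (?\<beta>' n) (?\<beta> n) \<le> ennreal (2 * R * t n)" for n
    by (rule wasserstein1_le_total_variation[OF prob_distr(2,1) _ _ norm_R(2,1)]) (use T[of _ n] in \<open>auto simp: abs_le_iff\<close>)
  moreover have "wasserstein1 ?\<gamma> (?\<beta>' n) \<le> d n" for n
    unfolding d_def
    using wasserstein1_distr_le[OF prob(2) meas(2) meas(1)[of n]] by (simp add: norm_minus_commute)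
  moreover have "wasserstein1 ?\<gamma> (?\<beta> n) \<le> wasserstein1 ?\<gamma> (?\<beta>' n) + wasserstein1 (?\<beta>' n) (?\<beta> n)" for n
    by (rule wasserstein1_triangle[OF _ _ _ compact_cball cball(2)]) simp_all
  ultimately have from': "wasserstein1 ?\<gamma> (?\<beta> n) \<le> ennreal (2 * R * t n) + d n" for n
    unfolding add.commute[of "ennreal (2 * R * t n)"] by (meson add_mono order_trans)
  show ?thesis
  proof (rule tendsto_ennreal_perturbed)
    have "wasserstein1 \<alpha> (?\<beta> n) \<le> wasserstein1 \<alpha> ?\<gamma> + wasserstein1 ?\<gamma> (?\<beta> n)" for n
      by (rule wasserstein1_triangle[OF _ _ _ compact_cball cball(3)]) (simp_all add: \<alpha>)
    then show "wasserstein1 \<alpha> (?\<beta> n) \<le> wasserstein1 \<alpha> ?\<gamma> + (ennreal (2 * R * t n) + d n)" for n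
      using from' by (meson add_left_mono order_trans)
    have "wasserstein1 \<alpha> ?\<gamma> \<le> wasserstein1 \<alpha> (?\<beta> n) + wasserstein1 (?\<beta> n) ?\<gamma>" for n
      by (rule wasserstein1_triangle[OF _ _ _ compact_cball cball(1)]) (simp_all add: \<alpha>)
    then show "wasserstein1 \<alpha> ?\<gamma> \<le> wasserstein1 \<alpha> (?\<beta> n) + (ennreal (2 * R * t n) + d n)" for n
      using to by (meson add_left_mono order_trans)
    have "d n \<le> (\<integral>\<^sup>+x. ennreal (2 * R) \<partial>Q)" for n
      unfolding d_def by (intro nn_integral_mono ennreal_leI diff)
    then have "d n \<le> ennreal (2 * R)" for n
      by (simp add: Q.emeasure_space_1)
    then have "d n < top" for n
      using le_less_trans[OF _ ennreal_less_top] by blast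
    then show "ennreal (2 * R * t n) + d n < \<infinity>" for n
      by simp
    show "(\<lambda>n. wasserstein1 \<alpha> ?\<gamma>) \<longlonglongrightarrow> wasserstein1 \<alpha> ?\<gamma>"
      by simp
    have "d \<longlonglongrightarrow> (\<integral>\<^sup>+x. 0 \<partial>Q)"
      unfolding d_def
    proof (rule nn_integral_dominated_convergence[where w = "\<lambda>_. ennreal (2 * R)"])
      show "AE x in Q. (\<lambda>n. ennreal (norm (g n x - g' x))) \<longlonglongrightarrow> 0"
      proof (rule AE_I2)
        show "(\<lambda>n. ennreal (norm (g n x - g' x))) \<longlonglongrightarrow> 0" for x
          using tendsto_ennrealI[OF tendsto_norm_zero[OF LIM_zero[OF lim[of x]]]] by simp
      qed
    qed (auto simp: Q.emeasure_space_1 intro!: ennreal_leI diff)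
    moreover have "(\<lambda>n. ennreal (2 * R * t n)) \<longlonglongrightarrow> 0"
      using tendsto_ennrealI[OF tendsto_mult_left[OF tv, of "2 * R"]] by (simp add: t_def)
    ultimately show "(\<lambda>n. ennreal (2 * R * t n) + d n) \<longlonglongrightarrow> 0"
      using tendsto_add by fastforce
  qed
qed

section \<open>Continuity of the functional and stability of minimisers\<close>

lemma J2_tendsto:
  fixes A :: "real ^ 'n \<Rightarrow> real ^ 'k"
  assumes A: "linear A" and \<alpha>: "sets \<alpha> = sets borel"
    and prob: "\<And>n. prob_space (P n)" "prob_space Q"
    and sets: "\<And>n. sets (P n) = sets borel" "sets Q = sets borel"
    and C: "compact C" "\<And>n. supported_on (P n) C" "supported_on Q C"
    and meas: "\<And>n. g n \<in> borel_measurable borel" "g' \<in> borel_measurable borel"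
    and R: "\<And>n y. norm (g n y) \<le> R" "\<And>y. norm (g' y) \<le> R"
    and lim: "\<And>y. (\<lambda>n. g n y) \<longlonglongrightarrow> g' y"
    and tv: "(\<lambda>n. tv_dist (P n) Q) \<longlonglongrightarrow> 0"
  shows "(\<lambda>n. J2 A \<alpha> (g n) lam (P n)) \<longlonglongrightarrow> J2 A \<alpha> g' lam Q"
proof -
  note [measurable_cong] = sets(2)
  note [measurable] = meas
  have bl: "bounded_linear A"
    using A by (simp add: linear_conv_bounded_linear)
  have [measurable]: "A \<in> borel_measurable borel"
    by (rule borel_measurable_continuous_onI) (rule linear_continuous_on[OF bl])
  obtain a where a: "\<And>x. norm (A x) \<le> norm x * a" "a > 0"
    using bounded_linear.pos_bounded[OF bl] by blast
  obtain c where c: "\<And>y. y \<in> C \<Longrightarrow> norm y \<le> c"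
    using compact_imp_bounded[OF C(1)] by (auto simp: bounded_iff)
  have sets': "sets (P n) = sets Q" for n
    using sets by simp
  \<comment> \<open>On \<open>C\<close> the residual is bounded uniformly in \<open>n\<close>:
    \<open>c\<close> bounds the data, \<open>R\<close> the reconstructions and \<open>a\<close> the
    operator norm of \<open>A\<close>.\<close>
  have bound: "(norm (y - A (g n y)))\<^sup>2 \<le> (c + R * a)\<^sup>2" if "y \<in> C" for n y
  proof (rule power_mono)
    have "norm (y - A (g n y)) \<le> norm y + norm (A (g n y))"
      by (rule norm_triangle_ineq4)
    also have "\<dots> \<le> c + R * a"
      using c[OF that] a(1)[of "g n y"] mult_right_mono[OF R(1)[of n y], of a] a(2) by linarith
    finally show "norm (y - A (g n y)) \<le> c + R * a" .
  qed simp
  have "(\<lambda>n. \<integral>\<^sup>+y. ennreal ((norm (y - A (g n y)))\<^sup>2) \<partial>P n)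
    \<longlonglongrightarrow> (\<integral>\<^sup>+y. ennreal ((norm (y - A (g' y)))\<^sup>2) \<partial>Q)"
  proof (rule nn_integral_tendsto_total_variation[OF prob sets' _ _ _ _ _ _ tv])
    show "AE y in P n. (norm (y - A (g n y)))\<^sup>2 \<le> (c + R * a)\<^sup>2" for n
      using C(2)[of n] unfolding supported_on_def by eventually_elim (rule bound)
    show "AE y in Q. (norm (y - A (g n y)))\<^sup>2 \<le> (c + R * a)\<^sup>2" for n
      using C(3) unfolding supported_on_def by eventually_elim (rule bound)
    show "(\<lambda>n. (norm (y - A (g n y)))\<^sup>2) \<longlonglongrightarrow> (norm (y - A (g' y)))\<^sup>2" for y
      by (intro tendsto_intros bounded_linear.tendsto[OF bl] lim)
  qed simp_all
  moreover have "(\<lambda>n. wasserstein1 \<alpha> (distr (P n) borel (g n))) \<longlonglongrightarrow> wasserstein1 \<alpha> (distr Q borel g')"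
    by (rule wasserstein1_tendsto_total_variation[OF \<alpha> prob sets' _ _ R lim tv]) measurable
  ultimately show ?thesis
    unfolding J2_def by (intro tendsto_add ennreal_tendsto_cmult) simp_all
qed

theorem theorem2:
  fixes A :: "real ^ 'n \<Rightarrow> real ^ 'k"
    and \<pi>x :: "(real ^ 'n) measure"
    and \<pi>y :: "real \<Rightarrow> (real ^ 'k) measure"
    and G :: "'p::euclidean_space \<Rightarrow> real ^ 'k \<Rightarrow> real ^ 'n"
    and K :: "'p set"
    and C :: "(real ^ 'k) set"
    and lam \<delta> :: real
    and \<delta>s :: "nat \<Rightarrow> real"
    and \<phi> :: "nat \<Rightarrow> 'p"
  assumes linear_A: "linear A"
    and prob_x: "prob_space \<pi>x" "sets \<pi>x = sets borel"
    and prob_y: "\<And>d. d \<ge> 0 \<Longrightarrow> prob_space (\<pi>y d)" "\<And>d. d \<ge> 0 \<Longrightarrow> sets (\<pi>y d) = sets borel"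
    and meas_G: "\<And>p. p \<in> K \<Longrightarrow> G p \<in> borel_measurable borel"
    and A1_x: "\<exists>S. compact S \<and> supported_on \<pi>x S"
    and A1_y: "compact C" "\<And>d. d \<ge> 0 \<Longrightarrow> supported_on (\<pi>y d) C"
    and A2: "compact K" "K \<noteq> {}"
    and A3: "\<And>ps p y. (\<And>n. ps n \<in> K) \<Longrightarrow> p \<in> K \<Longrightarrow> ps \<longlonglongrightarrow> p
               \<Longrightarrow> (\<lambda>n. G (ps n) y) \<longlonglongrightarrow> G p y"
    and A4: "(SUP p\<in>K. sup_norm (G p)) < \<infinity>"
    and lam: "lam > 0"
    and \<delta>s: "\<And>n. \<delta>s n \<ge> 0" "\<delta> \<ge> 0" "\<delta>s \<longlonglongrightarrow> \<delta>"
    and tv: "(\<lambda>n. tv_dist (\<pi>y (\<delta>s n)) (\<pi>y \<delta>)) \<longlonglongrightarrow> 0"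
    and \<phi>_min: "\<And>n. is_arg_min (\<lambda>p. J2 A \<pi>x (G p) lam (\<pi>y (\<delta>s n))) (\<lambda>p. p \<in> K) (\<phi> n)"
  shows "\<exists>r \<phi>'. strict_mono (r :: nat \<Rightarrow> nat)
           \<and> is_arg_min (\<lambda>p. J2 A \<pi>x (G p) lam (\<pi>y \<delta>)) (\<lambda>p. p \<in> K) \<phi>'
           \<and> (\<forall>y. (\<lambda>n. G (\<phi> (r n)) y) \<longlonglongrightarrow> G \<phi>' y)"
proof -
  \<comment> \<open>By \<open>A4\<close> the supremum is finite, so passing to a real number loses
    nothing and \<open>R\<close> bounds all maps of the family uniformly.\<close>
  define R where "R = enn2real (SUP p\<in>K. sup_norm (G p))"
  have R: "norm (G p y) \<le> R" if "p \<in> K" for p y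
  proof -
    have "ennreal (norm (G p y)) \<le> sup_norm (G p)"
      unfolding sup_norm_def by (rule SUP_upper) simp
    also have "\<dots> \<le> (SUP p\<in>K. sup_norm (G p))"
      using that by (rule SUP_upper)
    also have "\<dots> = ennreal R"
      using A4 by (simp add: R_def)
    finally show ?thesis
      by (simp add: R_def ennreal_le_iff)
  qed
  have \<phi>_in: "\<phi> n \<in> K" for n
    using \<phi>_min[of n] by (simp add: is_arg_min_def)
  have \<phi>_le: "J2 A \<pi>x (G (\<phi> n)) lam (\<pi>y (\<delta>s n)) \<le> J2 A \<pi>x (G p) lam (\<pi>y (\<delta>s n))" if "p \<in> K" for n p
    using \<phi>_min[of n] that by (auto simp: is_arg_min_def not_less)
  obtain \<phi>' r where \<phi>': "\<phi>' \<in> K" and r: "strict_mono (r :: nat \<Rightarrow> nat)" and conv: "(\<phi> \<circ> r) \<longlonglongrightarrow> \<phi>'"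
    using A2(1) \<phi>_in unfolding compact_def by blast
  have G_lim: "(\<lambda>n. G (\<phi> (r n)) y) \<longlonglongrightarrow> G \<phi>' y" for y
    using A3[of "\<phi> \<circ> r" \<phi>' y] \<phi>_in \<phi>' conv by simp
  have tv_r: "(\<lambda>n. tv_dist (\<pi>y (\<delta>s (r n))) (\<pi>y \<delta>)) \<longlonglongrightarrow> 0"
    using LIMSEQ_subseq_LIMSEQ[OF tv r] by (simp add: comp_def)
  \<comment> \<open>Stated for a general sequence of parameters because it is used twice: along the
    minimisers and along a constant competitor. The measure varies in both cases, so the competitor
    also needs a limit.\<close>
  have J_lim: "(\<lambda>n. J2 A \<pi>x (G (ps n)) lam (\<pi>y (\<delta>s (r n)))) \<longlonglongrightarrow> J2 A \<pi>x (G p) lam (\<pi>y \<delta>)"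
    if "\<And>n. ps n \<in> K" "p \<in> K" "\<And>y. (\<lambda>n. G (ps n) y) \<longlonglongrightarrow> G p y" for ps p
    using that \<delta>s(1,2) by (intro J2_tendsto[OF linear_A prob_x(2) _ _ _ _ A1_y(1), where R = R])
      (simp_all add: prob_y A1_y meas_G R tv_r)
  have "J2 A \<pi>x (G \<phi>') lam (\<pi>y \<delta>) \<le> J2 A \<pi>x (G p) lam (\<pi>y \<delta>)" if "p \<in> K" for p
  proof (rule LIMSEQ_le)
    show "(\<lambda>n. J2 A \<pi>x (G (\<phi> (r n))) lam (\<pi>y (\<delta>s (r n)))) \<longlonglongrightarrow> J2 A \<pi>x (G \<phi>') lam (\<pi>y \<delta>)"
      by (rule J_lim) (use \<phi>_in \<phi>' G_lim in auto)
    show "(\<lambda>n. J2 A \<pi>x (G p) lam (\<pi>y (\<delta>s (r n)))) \<longlonglongrightarrow> J2 A \<pi>x (G p) lam (\<pi>y \<delta>)"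
      by (rule J_lim) (use that in auto)
    show "\<exists>N. \<forall>n\<ge>N. J2 A \<pi>x (G (\<phi> (r n))) lam (\<pi>y (\<delta>s (r n))) \<le> J2 A \<pi>x (G p) lam (\<pi>y (\<delta>s (r n)))"
      using \<phi>_le that by blast
  qed
  then have "is_arg_min (\<lambda>p. J2 A \<pi>x (G p) lam (\<pi>y \<delta>)) (\<lambda>p. p \<in> K) \<phi>'"
    using \<phi>' by (auto simp: is_arg_min_def not_less)
  with r G_lim show ?thesis
    by blast
qed

end
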